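(* Let $\eta_n>0$ and let $a_n,b_n$ be nonnegative real numbers. For every $n\geq 1$, the infimal coverage probability of the interval $C_{A,n}=[\hat\theta_A-a_n,\hat\theta_A+b_n]$, where $p_{A,n}(\theta)=P_{n,\theta}(\theta\in C_{A,n})$, is given by $$\inf_{\theta\in\mathbb{R}}p_{A,n}(\theta)=\Phi(n^{1/2}(a_n-\eta_n))-\Phi\left(n^{1/2}\left((a_n-b_n)/2-\sqrt{((a_n+b_n)/2)^2+\eta_n^2}\right)\right)$$ if $a_n\leq b_n$, and by $$\inf_{\theta\in\mathbb{R}}p_{A,n}(\theta)=\Phi(n^{1/2}(b_n-\eta_n))-\Phi\left(n^{1/2}\left((b_n-a_n)/2-\sqrt{((a_n+b_n)/2)^2+\eta_n^2}\right)\right)$$ if $a_n>b_n$.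
   Context: The data $y_1,\dots,y_n$ are i.i.d. $N(\theta,1)$ with $\theta\in\mathbb{R}$ unknown (variance known and equal to $1$); $P_{n,\theta}$ denotes the distribution of the sample when $\theta$ is the true parameter, and $\bar y=n^{-1}\sum_{i=1}^n y_i$. The tuning parameter $\eta_n$ is a positive real number. The adaptive LASSO estimator is $\hat\theta_A=0$ if $|\bar y|\leq\eta_n$ and $\hat\theta_A=\bar y-\eta_n^2/\bar y$ if $|\bar y|>\eta_n$. $\Phi$ is the standard normal cumulative distribution function. *)

theory Defs
  imports "HOL-Probability.Probability"
begin

text \<open>A sample \<open>y\<^sub>1, \<dots>, y\<^sub>n\<close> is a function on the index set \<open>{1..n}\<close>; under the parameter
  \<open>\<theta>\<close> its law is the \<open>n\<close>-fold product of the normal distribution with mean \<open>\<theta>\<close> and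
  variance 1 (the second argument of \<^const>\<open>normal_density\<close> is the standard deviation).\<close>

definition sample_dist :: "nat \<Rightarrow> real \<Rightarrow> (nat \<Rightarrow> real) measure" where
  "sample_dist n \<theta> = PiM {1..n} (\<lambda>_. density lborel (\<lambda>x. ennreal (normal_density \<theta> 1 x)))"

definition sample_mean :: "nat \<Rightarrow> (nat \<Rightarrow> real) \<Rightarrow> real" where
  "sample_mean n y = (\<Sum>i=1..n. y i) / real n"

definition adaptive_lasso :: "nat \<Rightarrow> real \<Rightarrow> (nat \<Rightarrow> real) \<Rightarrow> real" where
  "adaptive_lasso n \<eta> y =
     (if \<bar>sample_mean n y\<bar> \<le> \<eta> then 0 else sample_mean n y - \<eta>\<^sup>2 / sample_mean n y)"

definition conf_interval :: "nat \<Rightarrow> real \<Rightarrow> real \<Rightarrow> real \<Rightarrow> (nat \<Rightarrow> real) \<Rightarrow> real set" where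
  "conf_interval n \<eta> a b y = {adaptive_lasso n \<eta> y - a .. adaptive_lasso n \<eta> y + b}"

definition coverage :: "nat \<Rightarrow> real \<Rightarrow> real \<Rightarrow> real \<Rightarrow> real \<Rightarrow> real" where
  "coverage n \<eta> a b \<theta> = \<P>(y in sample_dist n \<theta>. \<theta> \<in> conf_interval n \<eta> a b y)"

definition std_normal_cdf :: "real \<Rightarrow> real" where
  "std_normal_cdf = cdf std_normal_distribution"

end

theory Submission
  imports Defs
begin

text \<open>The estimator is an odd, nondecreasing function of the sample mean, which is normal with mean
  \<open>\<theta>\<close> and standard deviation \<open>1 / sqrt n\<close>. Hence \<open>\<theta>\<close> is covered exactly when the sample mean
  lies in an interval \<open>[L, U]\<close>, and the coverage probability is the mass that the standard normal
  law gives to \<open>[L - \<theta>, U - \<theta>]\<close> scaled by \<open>sqrt n\<close>.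

  Solving \<open>x - \<eta>\<^sup>2 / x = c\<close> expresses the endpoints through the single function
  \<open>w(t) = sqrt (t\<^sup>2 + \<eta>\<^sup>2) - t\<close>, which for \<open>t > 0\<close> is the amount that the
  estimator subtracts from \<open>2 t + w(t)\<close>.
  With \<open>d = (a + b) / 2\<close>, the window \<open>[L - \<theta>, U - \<theta>]\<close> is

  \<^item> \<open>[- b - w(t + d), a - w(t)]\<close> for \<open>\<theta> = - a - 2 t\<close> with \<open>t > 0\<close>,
  \<^item> \<open>[- b - w(d - s), a + w(s)]\<close> for \<open>\<theta> = 2 s - a\<close> with \<open>0 \<le> s \<le> d\<close>,
  \<^item> \<open>[- b + w(t), a + w(t + d)]\<close> for \<open>\<theta> = b + 2 t\<close> with \<open>t > 0\<close>.

  The coverage jumps upwards at \<open>\<theta> = - a\<close>, because the estimator takes the value 0 with positive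
  probability. For \<open>a \<le> b\<close> the infimum is the limit from the left at this point, which is the mass
  of the window \<open>[- b - w(d), a - \<eta>]\<close>.

  That no \<open>\<theta>\<close> does worse follows from one comparison principle (\<open>std_normal_window_le\<close>): a window
  that is at least as long and whose midpoint is at least as close to 0 has at least as much
  standard normal mass. All three kinds of windows qualify; the decisive length comparison, for
  \<open>\<theta>\<close> outside \<open>[- a, b]\<close>, is the inequality \<open>w(s) + w(t) \<le> \<eta> + w(s + t)\<close> (\<open>lasso_shrinkage_add_le\<close>), a form of the convexity
  of \<open>w\<close>, and the midpoints are compared by \<open>0 < w \<le> \<eta>\<close> on \<open>[0, \<infinity>)\<close> and the monotonicity of \<open>w\<close>. The case \<open>a > b\<close> reduces
  to \<open>a < b\<close> by the reflection \<open>\<theta> \<mapsto> - \<theta>\<close>, which exchanges \<open>a\<close> and \<open>b\<close>.\<close>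

section \<open>The mass of windows under the standard normal law\<close>

lemma std_normal_cdf_diff:
  assumes "a \<le> b"
  shows "std_normal_cdf b - std_normal_cdf a = integral {a..b} std_normal_density"
    and "std_normal_cdf b - std_normal_cdf a = measure std_normal_distribution {a..b}"
proof -
  interpret real_distribution std_normal_distribution
    by (rule real_dist_normal_dist)
  have point: "measure std_normal_distribution {x} = 0" for x
    by (simp add: measure_def emeasure_density nn_integral_null_set)
  have "std_normal_cdf b - std_normal_cdf a = measure std_normal_distribution {a<..b}" if "a < b"
    using cdf_diff_eq[OF that] by (simp add: std_normal_cdf_def)
  moreover have "measure std_normal_distribution {a..b}
      = measure std_normal_distribution {a} + measure std_normal_distribution {a<..b}"
  proof -
    have "{a..b} = {a} \<union> {a<..b}" using assms by auto
    then show ?thesis using finite_measure_Union[of "{a}" "{a<..b}"] by simp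
  qed
  ultimately show m: "std_normal_cdf b - std_normal_cdf a = measure std_normal_distribution {a..b}"
    using assms point by (cases "a = b") auto
  have int: "set_integrable lborel {a..b} std_normal_density"
    by (intro borel_integrable_atLeastAtMost') (auto simp: normal_density_def intro!: continuous_intros)
  have "measure std_normal_distribution {a..b} = (LINT x|std_normal_distribution. indicator {a..b} x)"
    by simp
  also have "\<dots> = (LINT x:{a..b}|lborel. std_normal_density x)"
    by (subst integral_density) (auto simp: set_lebesgue_integral_def mult.commute)
  also have "\<dots> = integral {a..b} std_normal_density"
    by (rule set_borel_integral_eq_integral(2)[OF int])
  finally show "std_normal_cdf b - std_normal_cdf a = integral {a..b} std_normal_density"
    using m by simp
qed

lemma DERIV_std_normal_cdf: "(std_normal_cdf has_real_derivative std_normal_density x) (at x)"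
proof -
  \<comment> \<open>Anchoring the integral at \<open>x - 1\<close> makes \<open>x\<close> an interior point of its range of validity.\<close>
  have "((\<lambda>u. integral {x - 1..u} std_normal_density) has_real_derivative std_normal_density x)
      (at x within {x - 1..x + 1})"
    by (rule integral_has_real_derivative)
       (auto simp: normal_density_def intro!: continuous_intros)
  then have "((\<lambda>u. std_normal_cdf (x - 1) + integral {x - 1..u} std_normal_density)
      has_real_derivative std_normal_density x) (at x within {x - 1..x + 1})"
    by (auto intro!: derivative_eq_intros)
  then have "(std_normal_cdf has_real_derivative std_normal_density x) (at x within {x - 1..x + 1})"
    by (rule has_field_derivative_transform_within[of _ _ _ _ 1])
       (auto simp: std_normal_cdf_diff(1)[symmetric])
  then show ?thesis
    by (simp add: at_within_Icc_at)
qed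

lemma std_normal_density_le_iff:
  "std_normal_density x \<le> std_normal_density y \<longleftrightarrow> \<bar>y\<bar> \<le> \<bar>x\<bar>"
  by (simp add: normal_density_def divide_le_cancel abs_le_square_iff)

lemma std_normal_cdf_mono: "x \<le> y \<Longrightarrow> std_normal_cdf x \<le> std_normal_cdf y"
  using std_normal_cdf_diff(2)[of x y] measure_nonneg[of std_normal_distribution "{x..y}"]
  by linarith

lemma std_normal_cdf_minus: "std_normal_cdf (- x) = 1 - std_normal_cdf x"
proof -
  interpret real_distribution std_normal_distribution
    by (rule real_dist_normal_dist)
  define s where "s = (\<lambda>x. std_normal_cdf x + std_normal_cdf (- x))"
  have "(s has_real_derivative 0) (at x)" for x
    unfolding s_def
    by (auto intro!: derivative_eq_intros DERIV_std_normal_cdf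
        DERIV_chain2[OF DERIV_std_normal_cdf] simp: normal_density_def)
  then have const: "s x = s y" for x y
    using DERIV_isconst_all by blast
  \<comment> \<open>The constant value of \<open>s\<close> is read off from its limit at infinity.\<close>
  have "(s \<longlongrightarrow> 1 + 0) at_top"
    unfolding s_def std_normal_cdf_def
    by (intro tendsto_add cdf_lim_at_top_prob
        filterlim_compose[OF cdf_lim_at_bot] filterlim_uminus_at_bot_at_top)
  moreover have "s = (\<lambda>_. s x)"
    using const by blast
  ultimately have "((\<lambda>_. s x) \<longlongrightarrow> 1) (at_top :: real filter)"
    by simp
  then have "s x = 1"
    by (simp add: tendsto_const_iff)
  then show ?thesis
    by (simp add: s_def)
qed

text \<open>For a fixed half-length \<open>r\<close>, the mass \<open>G m\<close> of the window with midpoint \<open>m\<close> is even in \<open>m\<close>. It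
  increases for \<open>m \<le> 0\<close>, because there \<open>\<bar>m + r\<bar> \<le> \<bar>m - r\<bar>\<close>, so that moving the window to the right
  gains at least the density that it loses. A further extension of the window about its midpoint
  only adds mass.\<close>

lemma std_normal_window_le:
  assumes "l \<le> u" "u - l \<le> u' - l'" "\<bar>l' + u'\<bar> \<le> \<bar>l + u\<bar>"
  shows "std_normal_cdf u - std_normal_cdf l \<le> std_normal_cdf u' - std_normal_cdf l'"
proof -
  define r where "r = (u - l) / 2"
  have "r \<ge> 0" using assms by (simp add: r_def)
  define G where "G = (\<lambda>m. std_normal_cdf (m + r) - std_normal_cdf (m - r))"
  have G_even: "G (- m) = G m" for m
    using std_normal_cdf_minus[of "m - r"] std_normal_cdf_minus[of "m + r"] by (simp add: G_def)
  have G_mono: "G m \<le> G m'" if "m \<le> m'" "m' \<le> 0" for m m'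
  proof (rule DERIV_nonneg_imp_nondecreasing[OF that(1)], intro exI conjI)
    fix x assume x: "m \<le> x" "x \<le> m'"
    show "(G has_real_derivative std_normal_density (x + r) - std_normal_density (x - r)) (at x)"
      unfolding G_def
      by (auto intro!: derivative_eq_intros DERIV_chain2[OF DERIV_std_normal_cdf])
    show "0 \<le> std_normal_density (x + r) - std_normal_density (x - r)"
      using x that \<open>r \<ge> 0\<close> by (simp add: std_normal_density_le_iff)
  qed
  have "G ((l + u) / 2) = G (- \<bar>(l + u) / 2\<bar>)"
    using G_even by (simp add: abs_if)
  also have "\<dots> \<le> G (- \<bar>(l' + u') / 2\<bar>)"
    using assms by (intro G_mono) auto
  also have "\<dots> = G ((l' + u') / 2)"
    using G_even by (simp add: abs_if)
  also have "\<dots> \<le> std_normal_cdf u' - std_normal_cdf l'"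
    unfolding G_def using assms
    by (intro diff_mono std_normal_cdf_mono) (auto simp: r_def field_simps)
  finally show ?thesis
    by (simp add: G_def r_def field_simps)
qed

section \<open>The law of the sample mean\<close>

lemma sample_mean_standardised:
  assumes "n \<ge> 1"
  shows "distributed (sample_dist n \<theta>) lborel (\<lambda>y. sqrt (real n) * (sample_mean n y - \<theta>)) std_normal_density"
proof -
  let ?N = "density lborel (\<lambda>x. ennreal (normal_density \<theta> 1 x))"
  have N: "prob_space ?N"
    by (rule prob_space_normal_density) simp
  interpret prob_space "sample_dist n \<theta>"
    unfolding sample_dist_def by (intro prob_space_PiM N)
  have comp: "distr (sample_dist n \<theta>) borel (\<lambda>y. y i) = ?N" if "i \<in> {1..n}" for i
  proof -
    have "distr (sample_dist n \<theta>) borel (\<lambda>y. y i) = distr (sample_dist n \<theta>) ?N (\<lambda>y. y i)"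
      by (rule distr_cong) auto
    also have "\<dots> = ?N"
      unfolding sample_dist_def by (rule distr_PiM_component[OF N that])
    finally show ?thesis .
  qed
  have meas: "(\<lambda>y. y i) \<in> borel_measurable (sample_dist n \<theta>)" if "i \<in> {1..n}" for i
    unfolding sample_dist_def using measurable_component_singleton[OF that, of "\<lambda>_. ?N"] by simp
  have dist: "distributed (sample_dist n \<theta>) lborel (\<lambda>y. y i) (normal_density \<theta> 1)"
    if "i \<in> {1..n}" for i
    using comp[OF that] meas[OF that] by (auto simp: distributed_def cong: distr_cong)
  \<comment> \<open>Independence of the coordinates holds because their joint law is the product of their laws
    by construction; restricting to \<open>{1..n}\<close> changes no point of the sample space.\<close>
  have indep: "indep_vars (\<lambda>_. borel) (\<lambda>i y. y i) {1..n}"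
  proof (subst indep_vars_iff_distr_eq_PiM'[OF _ meas])
    have "distr (sample_dist n \<theta>) (Pi\<^sub>M {1..n} (\<lambda>_. borel)) (\<lambda>y. \<lambda>i\<in>{1..n}. y i)
        = distr (sample_dist n \<theta>) (sample_dist n \<theta>) (\<lambda>y. y)"
      by (rule distr_cong) (auto simp: sample_dist_def space_PiM restrict_PiE_iff intro!: sets_PiM_cong)
    also have "\<dots> = Pi\<^sub>M {1..n} (\<lambda>i. distr (sample_dist n \<theta>) borel (\<lambda>y. y i))"
      unfolding distr_id by (subst sample_dist_def, rule PiM_cong) (simp_all only: comp)
    finally show "distr (sample_dist n \<theta>) (Pi\<^sub>M {1..n} (\<lambda>_. borel)) (\<lambda>y. \<lambda>i\<in>{1..n}. y i)
        = Pi\<^sub>M {1..n} (\<lambda>i. distr (sample_dist n \<theta>) borel (\<lambda>y. y i))" .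
  qed (use assms in auto)
  have "distributed (sample_dist n \<theta>) lborel (\<lambda>y. \<Sum>i\<in>{1..n}. y i)
      (normal_density (\<Sum>i\<in>{1..n}. \<theta>) (sqrt (\<Sum>i\<in>{1..n}. 1\<^sup>2)))"
    using assms by (intro sum_indep_normal indep dist) auto
  then have "distributed (sample_dist n \<theta>) lborel (\<lambda>y. ((\<Sum>i\<in>{1..n}. y i) - real n * \<theta>) / sqrt (real n))
      std_normal_density"
    using assms by (subst (asm) normal_standard_normal_convert) auto
  moreover have "((\<Sum>i\<in>{1..n}. y i) - real n * \<theta>) / sqrt (real n)
      = sqrt (real n) * (sample_mean n y - \<theta>)" for y :: "nat \<Rightarrow> real"
  proof -
    have "real n = sqrt (real n) * sqrt (real n)" by simp
    then show ?thesis using assms unfolding sample_mean_def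
      by (simp add: field_simps del: real_sqrt_mult_self) 
  qed
  ultimately show ?thesis by simp
qed


section \<open>The estimator as a function of the sample mean\<close>

definition lasso_map :: "real \<Rightarrow> real \<Rightarrow> real" where
  "lasso_map \<eta> x = (if \<bar>x\<bar> \<le> \<eta> then 0 else x - \<eta>\<^sup>2 / x)"

text \<open>The positive root of \<open>w (2 t + w) = \<eta>\<^sup>2\<close>, that is, of \<open>w = \<eta>\<^sup>2 / x\<close> at \<open>x = 2 t + w\<close>. So for
  \<open>t > 0\<close> it is the amount by which the estimator shrinks the observation to the value \<open>2 t\<close>.\<close>

definition lasso_shrinkage :: "real \<Rightarrow> real \<Rightarrow> real" where
  "lasso_shrinkage \<eta> t = sqrt (t\<^sup>2 + \<eta>\<^sup>2) - t"

text \<open>The largest observation whose estimate is at most \<open>c\<close>. The value at \<open>c = 0\<close> belongs to the first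
  branch, as all observations in \<open>[- \<eta>, \<eta>]\<close> are estimated by 0; this is the point where the
  function jumps, from \<open>- \<eta>\<close> to \<open>\<eta>\<close>.\<close>

definition lasso_upper_inverse :: "real \<Rightarrow> real \<Rightarrow> real" where
  "lasso_upper_inverse \<eta> c =
     (if c \<ge> 0 then c + lasso_shrinkage \<eta> (c / 2) else c - lasso_shrinkage \<eta> (- c / 2))"

context
  fixes \<eta> :: real
  assumes eta_pos: "\<eta> > 0"
begin

lemma lasso_shrinkage_0: "lasso_shrinkage \<eta> 0 = \<eta>"
  using eta_pos by (simp add: lasso_shrinkage_def)

lemma lasso_shrinkage_pos: "lasso_shrinkage \<eta> t > 0"
  using eta_pos real_less_rsqrt[of t "t\<^sup>2 + \<eta>\<^sup>2"] by (simp add: lasso_shrinkage_def)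

lemma lasso_shrinkage_root: "lasso_shrinkage \<eta> t * (2 * t + lasso_shrinkage \<eta> t) = \<eta>\<^sup>2"
proof -
  have "lasso_shrinkage \<eta> t * (2 * t + lasso_shrinkage \<eta> t) = (sqrt (t\<^sup>2 + \<eta>\<^sup>2))\<^sup>2 - t\<^sup>2"
    by (simp add: lasso_shrinkage_def power2_eq_square algebra_simps)
  then show ?thesis by simp
qed

text \<open>Convexity of the function \<open>w\<close>, in the only form used below: the drop of \<open>w\<close> over \<open>[0, s]\<close> is at
  least its drop over \<open>[t, s + t]\<close>. Squaring twice removes the square roots and leaves
  \<open>0 \<le> 2 s t \<eta> sqrt ((s + t)\<^sup>2 + \<eta>\<^sup>2) + 2 s t \<eta>\<^sup>2\<close>.\<close>

lemma lasso_shrinkage_add_le: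
  assumes "s \<ge> 0" "t \<ge> 0"
  shows "lasso_shrinkage \<eta> s + lasso_shrinkage \<eta> t \<le> \<eta> + lasso_shrinkage \<eta> (s + t)"
proof -
  define A B C where "A = sqrt (s\<^sup>2 + \<eta>\<^sup>2)" and "B = sqrt (t\<^sup>2 + \<eta>\<^sup>2)"
    and "C = sqrt ((s + t)\<^sup>2 + \<eta>\<^sup>2)"
  have sq: "A\<^sup>2 = s\<^sup>2 + \<eta>\<^sup>2" "B\<^sup>2 = t\<^sup>2 + \<eta>\<^sup>2" "C\<^sup>2 = (s + t)\<^sup>2 + \<eta>\<^sup>2"
    by (simp_all add: A_def B_def C_def)
  have nonneg: "A \<ge> 0" "B \<ge> 0" "C \<ge> 0"
    by (simp_all add: A_def B_def C_def)
  have st: "s * t * (\<eta> * C) \<ge> 0"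
    using assms eta_pos nonneg by simp
  have "(A * B)\<^sup>2 \<le> (s * t + \<eta> * C)\<^sup>2"
  proof -
    have "(s * t + \<eta> * C)\<^sup>2 - (A * B)\<^sup>2 = 2 * (s * t * (\<eta> * C)) + 2 * (s * t * \<eta>\<^sup>2)"
      unfolding power_mult_distrib power2_sum[of "s * t"] sq
      by (simp add: power2_eq_square algebra_simps)
    moreover have "s * t * \<eta>\<^sup>2 \<ge> 0"
      using assms by simp
    ultimately show ?thesis using st by linarith
  qed
  then have "A * B \<le> s * t + \<eta> * C"
    by (rule power2_le_imp_le) (use assms eta_pos nonneg in simp)
  then have "(A + B)\<^sup>2 \<le> (\<eta> + C)\<^sup>2"
    using sq by (simp add: power2_sum[of A B] power2_sum[of \<eta> C] power2_sum[of s t])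
  then have "A + B \<le> \<eta> + C"
    by (rule power2_le_imp_le) (use eta_pos nonneg in simp)
  then show ?thesis
    by (simp add: lasso_shrinkage_def A_def B_def C_def)
qed

text \<open>If \<open>w\<close> did not decrease from \<open>s\<close> to \<open>t\<close>, then \<open>w (2 t + w)\<close> would be larger at \<open>t\<close> than at \<open>s\<close>,
  but it has the constant value \<open>\<eta>\<^sup>2\<close>.\<close>

lemma lasso_shrinkage_strict_antimono:
  assumes "s < t"
  shows "lasso_shrinkage \<eta> t < lasso_shrinkage \<eta> s"
proof -
  let ?w = "lasso_shrinkage \<eta>"
  have "?w s * (2 * s + ?w s) < ?w t * (2 * t + ?w t)" if "?w s \<le> ?w t"
  proof (rule mult_le_less_imp_less[OF that])
    show "2 * s + ?w s < 2 * t + ?w t" using that assms by simp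
    show "0 < ?w s" by (rule lasso_shrinkage_pos)
    have "0 < ?w s * (2 * s + ?w s)"
      using eta_pos by (simp add: lasso_shrinkage_root)
    then show "0 \<le> 2 * s + ?w s"
      using lasso_shrinkage_pos[of s] by (simp add: zero_less_mult_iff)
  qed
  then show ?thesis by (force simp: lasso_shrinkage_root)
qed

lemma lasso_shrinkage_antimono: "s \<le> t \<Longrightarrow> lasso_shrinkage \<eta> t \<le> lasso_shrinkage \<eta> s"
  using lasso_shrinkage_strict_antimono[of s t] by (cases "s = t") auto

lemma lasso_shrinkage_le: "t \<ge> 0 \<Longrightarrow> lasso_shrinkage \<eta> t \<le> \<eta>"
  using lasso_shrinkage_antimono[of 0 t] by (simp add: lasso_shrinkage_0)

lemma lasso_map_minus: "lasso_map \<eta> (- x) = - lasso_map \<eta> x"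
  by (simp add: lasso_map_def)

text \<open>Outside \<open>[- \<eta>, \<eta>]\<close> the inequality is quadratic in the observation \<open>x\<close>. The product of the two roots
  of \<open>x (x - c) = \<eta>\<^sup>2\<close> is \<open>- \<eta>\<^sup>2\<close>; the root with the sign of \<open>c\<close> (the positive one if \<open>c = 0\<close>) lies outside \<open>(- \<eta>, \<eta>)\<close> and is
  the threshold, whereas the other one lies in \<open>[- \<eta>, \<eta>]\<close>, where the estimator is 0 and the
  quadratic equation irrelevant.\<close>

lemma lasso_map_le_iff: "lasso_map \<eta> x \<le> c \<longleftrightarrow> x \<le> lasso_upper_inverse \<eta> c"
proof (cases "c \<ge> 0")
  case True
  define w where "w = lasso_shrinkage \<eta> (c / 2)"
  have w: "0 < w" "w \<le> \<eta>" "w * (c + w) = \<eta>\<^sup>2"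
    using lasso_shrinkage_pos lasso_shrinkage_le[of "c / 2"] lasso_shrinkage_root[of "c / 2"] True
    by (auto simp: w_def)
  have ge: "\<eta> \<le> c + w"
  proof (rule ccontr)
    assume "\<not> \<eta> \<le> c + w"
    then have "w * (c + w) < \<eta> * \<eta>"
      using w True eta_pos by (intro mult_le_less_imp_less) auto
    then show False using w by (simp add: power2_eq_square)
  qed
  have fac: "x * (x - c) - \<eta>\<^sup>2 = (x - (c + w)) * (x + w)"
    unfolding w(3)[symmetric] by (simp add: algebra_simps)
  consider "\<bar>x\<bar> \<le> \<eta>" | "x > \<eta>" | "x < - \<eta>" by linarith
  then have "lasso_map \<eta> x \<le> c \<longleftrightarrow> x \<le> c + w"
  proof cases
    case 1
    then show ?thesis using True ge by (simp add: lasso_map_def)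
  next
    case 2
    then have "lasso_map \<eta> x \<le> c \<longleftrightarrow> x * (x - c) - \<eta>\<^sup>2 \<le> 0"
      using eta_pos by (simp add: lasso_map_def field_simps)
    also have "\<dots> \<longleftrightarrow> x \<le> c + w"
      unfolding fac using 2 w eta_pos by (simp add: mult_le_0_iff)
    finally show ?thesis .
  next
    case 3
    have "x * (x - c) - \<eta>\<^sup>2 \<ge> 0"
      unfolding fac using 3 w eta_pos ge by (intro mult_nonpos_nonpos) auto
    then have "lasso_map \<eta> x \<le> c"
      using 3 eta_pos by (simp add: lasso_map_def field_simps)
    then show ?thesis using 3 ge eta_pos by simp
  qed
  then show ?thesis using True by (simp add: lasso_upper_inverse_def w_def)
next
  case False
  define w where "w = lasso_shrinkage \<eta> (- c / 2)"
  have w: "0 < w" "w < \<eta>" "w * (w - c) = \<eta>\<^sup>2"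
    using lasso_shrinkage_pos lasso_shrinkage_strict_antimono[of 0 "- c / 2"]
      lasso_shrinkage_root[of "- c / 2"] False
    by (auto simp: w_def lasso_shrinkage_0)
  have ge: "\<eta> < w - c"
  proof (rule ccontr)
    assume "\<not> \<eta> < w - c"
    then have "w * (w - c) < \<eta> * \<eta>"
      using w False by (intro mult_less_le_imp_less) auto
    then show False using w by (simp add: power2_eq_square)
  qed
  have fac: "x * (x - c) - \<eta>\<^sup>2 = (x - w) * (x - (c - w))"
    unfolding w(3)[symmetric] by (simp add: algebra_simps)
  consider "\<bar>x\<bar> \<le> \<eta>" | "x > \<eta>" | "x < - \<eta>" by linarith
  then have "lasso_map \<eta> x \<le> c \<longleftrightarrow> x \<le> c - w"
  proof cases
    case 1
    then show ?thesis using False ge by (simp add: lasso_map_def)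
  next
    case 2
    have "x * (x - c) - \<eta>\<^sup>2 > 0"
      unfolding fac using 2 w eta_pos ge by (intro mult_pos_pos) auto
    then have "\<not> lasso_map \<eta> x \<le> c"
      using 2 eta_pos by (simp add: lasso_map_def field_simps)
    then show ?thesis using 2 ge eta_pos by simp
  next
    case 3
    then have "lasso_map \<eta> x \<le> c \<longleftrightarrow> 0 \<le> x * (x - c) - \<eta>\<^sup>2"
      using eta_pos by (simp add: lasso_map_def field_simps)
    also have "\<dots> \<longleftrightarrow> x \<le> c - w"
      unfolding fac using 3 w eta_pos by (simp add: zero_le_mult_iff)
    finally show ?thesis .
  qed
  then show ?thesis using False by (simp add: lasso_upper_inverse_def w_def)
qed

lemma le_lasso_map_iff: "c \<le> lasso_map \<eta> x \<longleftrightarrow> - lasso_upper_inverse \<eta> (- c) \<le> x"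
  using lasso_map_le_iff[of "- x" "- c"] by (simp add: lasso_map_minus minus_le_iff)

lemma lasso_upper_inverse_mono:
  assumes "c \<le> c'"
  shows "lasso_upper_inverse \<eta> c \<le> lasso_upper_inverse \<eta> c'"
  using lasso_map_le_iff[of "lasso_upper_inverse \<eta> c" c] lasso_map_le_iff[of "lasso_upper_inverse \<eta> c" c'] assms
  by simp

lemma minus_lasso_upper_inverse_le: "- lasso_upper_inverse \<eta> (- c) \<le> lasso_upper_inverse \<eta> c"
  using lasso_shrinkage_pos[of 0] by (auto simp: lasso_upper_inverse_def)

section \<open>Coverage as the mass of a window\<close>

lemma coverage_eq:
  assumes "n \<ge> 1" "a \<ge> 0" "b \<ge> 0"
  shows "coverage n \<eta> a b \<theta> =
      std_normal_cdf (sqrt (real n) * (lasso_upper_inverse \<eta> (\<theta> + a) - \<theta>))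
      - std_normal_cdf (sqrt (real n) * (- lasso_upper_inverse \<eta> (b - \<theta>) - \<theta>))"
proof -
  define U L where "U = lasso_upper_inverse \<eta> (\<theta> + a)" and "L = - lasso_upper_inverse \<eta> (b - \<theta>)"
  define l u where "l = sqrt (real n) * (L - \<theta>)" and "u = sqrt (real n) * (U - \<theta>)"
  define Z where "Z = (\<lambda>y. sqrt (real n) * (sample_mean n y - \<theta>))"
  have "L \<le> lasso_upper_inverse \<eta> (\<theta> - b)"
    unfolding L_def using minus_lasso_upper_inverse_le[of "\<theta> - b"] by simp
  also have "\<dots> \<le> U"
    unfolding U_def using assms by (intro lasso_upper_inverse_mono) simp
  finally have "l \<le> u"
    by (simp add: l_def u_def mult_left_mono)
  have cover: "\<theta> \<in> conf_interval n \<eta> a b y \<longleftrightarrow> Z y \<in> {l..u}" for y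
  proof -
    have "adaptive_lasso n \<eta> y = lasso_map \<eta> (sample_mean n y)"
      by (simp add: adaptive_lasso_def lasso_map_def)
    then have "\<theta> \<in> conf_interval n \<eta> a b y \<longleftrightarrow>
        \<theta> - b \<le> lasso_map \<eta> (sample_mean n y) \<and> lasso_map \<eta> (sample_mean n y) \<le> \<theta> + a"
      by (auto simp: conf_interval_def)
    also have "\<dots> \<longleftrightarrow> L \<le> sample_mean n y \<and> sample_mean n y \<le> U"
      by (simp add: lasso_map_le_iff le_lasso_map_iff L_def U_def)
    also have "\<dots> \<longleftrightarrow> Z y \<in> {l..u}"
      using assms by (simp add: Z_def l_def u_def)
    finally show ?thesis .
  qed
  have Z: "distributed (sample_dist n \<theta>) lborel Z std_normal_density"
    unfolding Z_def by (rule sample_mean_standardised[OF assms(1)])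
  have "coverage n \<eta> a b \<theta> = measure (sample_dist n \<theta>) (Z -` {l..u} \<inter> space (sample_dist n \<theta>))"
    unfolding coverage_def cover by (rule arg_cong[of _ _ "measure _"]) auto
  also have "\<dots> = measure (distr (sample_dist n \<theta>) lborel Z) {l..u}"
    using distributed_measurable[OF Z] by (simp add: measure_distr)
  also have "\<dots> = measure std_normal_distribution {l..u}"
    by (simp add: distributed_distr_eq_density[OF Z])
  also have "\<dots> = std_normal_cdf u - std_normal_cdf l"
    by (rule std_normal_cdf_diff(2)[OF \<open>l \<le> u\<close>, symmetric])
  finally show ?thesis
    by (simp add: u_def l_def U_def L_def)
qed

text \<open>The estimator is odd and the error law symmetric, so reflecting the parameter exchanges the two
  arms of the confidence interval.\<close>

lemma coverage_minus:
  assumes "n \<ge> 1" "a \<ge> 0" "b \<ge> 0"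
  shows "coverage n \<eta> a b (- \<theta>) = coverage n \<eta> b a \<theta>"
proof -
  have neg: "sqrt (real n) * (- x - y) = - (sqrt (real n) * (x + y))" for x y
    by (simp add: algebra_simps)
  show ?thesis
    unfolding coverage_eq[OF assms] coverage_eq[OF assms(1,3,2)] neg std_normal_cdf_minus
    by (simp add: algebra_simps)
qed

text \<open>This and the next lemma give the windows for a parameter below \<open>- a\<close> and between \<open>- a\<close> and \<open>b\<close>; those
  for a parameter above \<open>b\<close> are obtained by \<open>coverage_minus\<close>. The parametrisation by \<open>t\<close>, or by \<open>s\<close>
  and \<open>t\<close>, makes the arguments of \<^const>\<open>lasso_shrinkage\<close> nonnegative.\<close>

lemma coverage_below:
  assumes "n \<ge> 1" "a \<ge> 0" "b \<ge> 0" "t > 0"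
  shows "coverage n \<eta> a b (- a - 2 * t) =
      std_normal_cdf (sqrt (real n) * (a - lasso_shrinkage \<eta> t))
      - std_normal_cdf (sqrt (real n) * (- b - lasso_shrinkage \<eta> (t + (a + b) / 2)))"
  using assms unfolding coverage_eq[OF assms(1-3)]
  by (simp add: lasso_upper_inverse_def add_divide_distrib algebra_simps)

lemma coverage_between:
  assumes "n \<ge> 1" "a \<ge> 0" "b \<ge> 0" "s \<ge> 0" "t \<ge> 0" "s + t = (a + b) / 2"
  shows "coverage n \<eta> a b (2 * s - a) =
      std_normal_cdf (sqrt (real n) * (a + lasso_shrinkage \<eta> s))
      - std_normal_cdf (sqrt (real n) * (- b - lasso_shrinkage \<eta> t))"
proof -
  have "b - (2 * s - a) = 2 * t"
    using assms(6) by simp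
  moreover have minus: "- (2 * t) - w - (2 * s - a) = - b - w" for w
    using assms(6) by simp
  ultimately show ?thesis
    using assms(4,5) unfolding coverage_eq[OF assms(1-3)] \<open>b - (2 * s - a) = 2 * t\<close>
    by (simp add: lasso_upper_inverse_def minus add.commute[of a])
qed

section \<open>The infimal coverage\<close>

text \<open>Every window is compared with the extremal window \<open>[- b - w(d), a - \<eta>]\<close>, whose midpoint is not
  positive because \<open>a \<le> b\<close>. Its length is \<open>a + b + w(d) - \<eta>\<close>, and the sum of its endpoints has the
  absolute value \<open>b - a + \<eta> + w(d)\<close>; these are the two bounds that a competing window has to meet.\<close>

lemma coverage_ge:
  assumes "n \<ge> 1" "a \<ge> 0" "a \<le> b"
  defines "d \<equiv> (a + b) / 2"
  shows "coverage n \<eta> a b \<theta> \<ge>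
      std_normal_cdf (sqrt (real n) * (a - \<eta>))
      - std_normal_cdf (sqrt (real n) * (- b - lasso_shrinkage \<eta> d))"
proof -
  let ?w = "lasso_shrinkage \<eta>"
  have b: "b \<ge> 0" and d: "d \<ge> 0"
    using assms by auto
  have wd: "\<eta> \<le> a + b + ?w d"
  proof -
    have "\<eta> \<le> sqrt (d\<^sup>2 + \<eta>\<^sup>2)"
      by (rule real_le_rsqrt) simp
    then have "\<eta> - d \<le> ?w d"
      by (simp add: lasso_shrinkage_def)
    then show ?thesis
      using d by (simp add: d_def field_simps)
  qed
  have window: "std_normal_cdf (sqrt (real n) * (a - \<eta>)) - std_normal_cdf (sqrt (real n) * (- b - ?w d))
      \<le> std_normal_cdf (sqrt (real n) * u) - std_normal_cdf (sqrt (real n) * l)"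
    if "a + b + ?w d - \<eta> \<le> u - l" "\<bar>l + u\<bar> \<le> b - a + \<eta> + ?w d" for l u
  proof (rule std_normal_window_le)
    show "sqrt (real n) * (- b - ?w d) \<le> sqrt (real n) * (a - \<eta>)"
      using wd by (intro mult_left_mono) auto
    show "sqrt (real n) * (a - \<eta>) - sqrt (real n) * (- b - ?w d)
        \<le> sqrt (real n) * u - sqrt (real n) * l"
      unfolding right_diff_distrib[symmetric] using that by (intro mult_left_mono) auto
    have "\<bar>l + u\<bar> \<le> \<bar>(- b - ?w d) + (a - \<eta>)\<bar>"
      using that by linarith
    then show "\<bar>sqrt (real n) * l + sqrt (real n) * u\<bar>
        \<le> \<bar>sqrt (real n) * (- b - ?w d) + sqrt (real n) * (a - \<eta>)\<bar>"
      unfolding distrib_left[symmetric] abs_mult by (intro mult_left_mono) auto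
  qed
  have outside: "\<eta> + ?w (t + d) \<ge> ?w t + ?w d" "?w t \<le> \<eta>" "?w (t + d) \<le> ?w d"
    "0 < ?w t" "0 < ?w (t + d)" if "t > 0" for t
    using lasso_shrinkage_add_le[of t d] lasso_shrinkage_le[of t] lasso_shrinkage_pos
      lasso_shrinkage_antimono[of d "t + d"] that d by auto
  consider "\<theta> < - a" | "- a \<le> \<theta>" "\<theta> \<le> b" | "b < \<theta>" by linarith
  then show ?thesis
  proof cases
    case 1
    define t where "t = (- a - \<theta>) / 2"
    have t: "t > 0" "\<theta> = - a - 2 * t"
      using 1 by (auto simp: t_def field_simps)
    show ?thesis
      unfolding t(2) coverage_below[OF assms(1,2) b t(1)] d_def[symmetric]
      using outside[OF t(1)] assms(3) by (intro window) auto
  next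
    case 2
    define s t where "s = (\<theta> + a) / 2" and "t = (b - \<theta>) / 2"
    have st: "s \<ge> 0" "t \<ge> 0" "s + t = (a + b) / 2" "\<theta> = 2 * s - a"
      using 2 by (auto simp: s_def t_def field_simps)
    have "?w s \<le> \<eta>" "?w t \<le> \<eta>" "?w d \<le> ?w t" "0 < ?w s" "0 < ?w d"
      using lasso_shrinkage_le lasso_shrinkage_antimono[of t d] lasso_shrinkage_pos st
      by (auto simp: d_def)
    then show ?thesis
      unfolding st(4) coverage_between[OF assms(1,2) b st(1-3)]
      using assms(3) eta_pos by (intro window) auto
  next
    case 3
    define t where "t = (\<theta> - b) / 2"
    have t: "t > 0" "\<theta> = - (- b - 2 * t)" "(b + a) / 2 = d"
      using 3 by (auto simp: t_def d_def field_simps)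
    show ?thesis
      unfolding t(2) coverage_minus[OF assms(1,2) b] coverage_below[OF assms(1) b assms(2) t(1)] t(3)
      using outside[OF t(1)] assms(3) by (intro window) auto
  qed
qed

text \<open>By \<open>coverage_ge\<close> the right-hand side is a lower bound; it is the limit of the coverage at
  \<open>- a - 2 t\<close> as \<open>t\<close> decreases to 0, hence the greatest lower bound.\<close>

lemma INF_coverage:
  assumes "n \<ge> 1" "a \<ge> 0" "a \<le> b"
  shows "(INF \<theta>\<in>UNIV. coverage n \<eta> a b \<theta>) =
      std_normal_cdf (sqrt (real n) * (a - \<eta>))
      - std_normal_cdf (sqrt (real n) * ((a - b) / 2 - sqrt (((a + b) / 2)\<^sup>2 + \<eta>\<^sup>2)))"
    (is "?I = ?m")
proof -
  let ?w = "lasso_shrinkage \<eta>"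
  define d where "d = (a + b) / 2"
  have m: "?m = std_normal_cdf (sqrt (real n) * (a - \<eta>))
      - std_normal_cdf (sqrt (real n) * (- b - ?w d))"
    by (simp add: lasso_shrinkage_def d_def field_simps)
  have ge: "?m \<le> coverage n \<eta> a b \<theta>" for \<theta>
    unfolding m d_def by (rule coverage_ge[OF assms])
  define f where "f = (\<lambda>t. std_normal_cdf (sqrt (real n) * (a - ?w t))
      - std_normal_cdf (sqrt (real n) * (- b - ?w (t + d))))"
  have "isCont f 0"
    unfolding f_def lasso_shrinkage_def
    by (intro continuous_intros isCont_o2[OF _ DERIV_isCont[OF DERIV_std_normal_cdf]])
  then have "(f \<longlongrightarrow> f 0) (at_right 0)"
    unfolding isCont_def by (rule tendsto_mono[rotated]) (simp add: at_le)
  moreover have "f 0 = ?m"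
    unfolding m by (simp add: f_def lasso_shrinkage_0)
  moreover have "eventually (\<lambda>t. ?I \<le> f t) (at_right 0)"
  proof (rule eventually_at_rightI[of 0 1])
    fix t :: real assume "t \<in> {0<..<1}"
    then have "f t = coverage n \<eta> a b (- a - 2 * t)"
      using coverage_below[of n a b t] assms by (simp add: f_def d_def)
    moreover have "bdd_below (range (coverage n \<eta> a b))"
      using ge by (rule bdd_belowI2)
    ultimately show "?I \<le> f t"
      by (auto intro: cINF_lower)
  qed simp
  ultimately have "?I \<le> ?m"
    using tendsto_lowerbound[of f ?m "at_right 0" ?I] by simp
  moreover have "?m \<le> ?I"
    by (rule cINF_greatest) (auto intro: ge)
  ultimately show ?thesis by (rule antisym)
qed

end

theorem proposition3:
  fixes n :: nat and \<eta> a b :: real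
  assumes "n \<ge> 1" and "\<eta> > 0" and "a \<ge> 0" and "b \<ge> 0"
  shows "(a \<le> b \<longrightarrow>
           (INF \<theta>\<in>UNIV. coverage n \<eta> a b \<theta>) =
             std_normal_cdf (sqrt (real n) * (a - \<eta>))
             - std_normal_cdf (sqrt (real n) * ((a - b) / 2 - sqrt (((a + b) / 2)\<^sup>2 + \<eta>\<^sup>2))))
       \<and> (a > b \<longrightarrow>
           (INF \<theta>\<in>UNIV. coverage n \<eta> a b \<theta>) =
             std_normal_cdf (sqrt (real n) * (b - \<eta>))
             - std_normal_cdf (sqrt (real n) * ((b - a) / 2 - sqrt (((a + b) / 2)\<^sup>2 + \<eta>\<^sup>2))))"
proof (intro conjI impI)
  assume "a \<le> b"
  then show "(INF \<theta>\<in>UNIV. coverage n \<eta> a b \<theta>) =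
      std_normal_cdf (sqrt (real n) * (a - \<eta>))
      - std_normal_cdf (sqrt (real n) * ((a - b) / 2 - sqrt (((a + b) / 2)\<^sup>2 + \<eta>\<^sup>2)))"
    using assms by (intro INF_coverage)
next
  assume "a > b"
  have "surj (uminus :: real \<Rightarrow> real)"
    by (rule surjI[of _ uminus]) simp
  then have "range (coverage n \<eta> a b) = range (\<lambda>\<theta>. coverage n \<eta> a b (- \<theta>))"
    by (metis image_image)
  also have "\<dots> = range (coverage n \<eta> b a)"
    using assms by (simp add: coverage_minus)
  finally show "(INF \<theta>\<in>UNIV. coverage n \<eta> a b \<theta>) =
      std_normal_cdf (sqrt (real n) * (b - \<eta>))
      - std_normal_cdf (sqrt (real n) * ((b - a) / 2 - sqrt (((a + b) / 2)\<^sup>2 + \<eta>\<^sup>2)))"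
    using assms INF_coverage[of \<eta> n b a] \<open>a > b\<close> by (simp add: add.commute)
qed

end
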